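(* Let $\mathcal{G} = (\mathcal{V}, \mathcal{E}, |\cdot|)$ be a finite tessellating metric graph. Then $$\sum_{e \in \mathcal{E}} - c(e)\,|e| = 1.$$
   Context: **Finite tessellating metric graph.** $\mathcal{G}_d = (\mathcal{V}, \mathcal{E})$ is an unoriented graph with finite vertex set $\mathcal{V}$ and finite edge set $\mathcal{E}$; it is connected and simple (no loops or multiple edges). For $v\in\mathcal{V}$, $\mathcal{E}_v$ is the set of edges incident to $v$ and $\deg(v)=\#\mathcal{E}_v$. The graph is planar with a fixed planar embedding, so that $\mathcal{G}_d$ is regarded as a (closed) subset of $\mathbb{R}^2$. $\mathcal{T}$ is the set of faces (called tiles), i.e. the closures of the connected components of $\mathbb{R}^2\setminus\mathcal{G}_d$ (the unbounded one included). It is assumed that: - each compact subset of $\mathbb{R}^2$ intersects only finitely many tiles; - each bounded tile $T$ is a closed topological disc (the image of the closed unit ball of $\mathbb{R}^2$ under a homeomorphism $\mathbb{R}^2\to\mathbb{R}^2$) and $\partial T$ consists of a finite cycle of at least three edges; - each edge is contained in the boundary of precisely two different tiles; - each vertex has degree $\ge 3$. (No condition is imposed on the shape of the unbounded tile.) Each edge $e$ is assigned a length $|e|\in(0,\infty)$, and $\mathcal{G}=(\mathcal{V},\mathcal{E},|\cdot|)$ is then called a finite tessellating metric graph. **Characteristic values.** For $v\in\mathcal{V}$, $m(v)=\sum_{e\in\mathcal{E}_v}|e|$. For $T\in\mathcal{T}$, let $\mathcal{E}_T=\{e\in\mathcal{E} : e\subseteq\partial T\}$ and set $p(T)=\sum_{e\in\mathcal{E}_T}|e|$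 if $T$ is bounded and $p(T)=\infty$ if $T$ is unbounded. For $e\in\mathcal{E}$, $$c(e)=\frac1{|e|}-\sum_{v: v\in e}\frac1{m(v)}-\sum_{T: e\subseteq\partial T}\frac1{p(T)},$$ the sums being over the two endpoints of $e$ and the two tiles containing $e$ in their boundary, with the convention $1/\infty=0$. *)

theory Defs
  imports "HOL-Analysis.Analysis"
begin

(* An edge is the set of its two endpoints, so multiple edges cannot occur; loops are excluded
   by "card e = 2" in simple_graph.  The fields vpos and earc are the fixed planar embedding:
   vpos v is the point representing v, and earc e the closed arc representing e. *)
record 'v embedded_metric_graph =
  vertices :: "'v set"
  edges :: "'v set set"
  vpos :: "'v \<Rightarrow> real^2"
  earc :: "'v set \<Rightarrow> (real^2) set"
  elen :: "'v set \<Rightarrow> real"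

definition simple_graph :: "'v set \<Rightarrow> 'v set set \<Rightarrow> bool" where
  "simple_graph V E \<longleftrightarrow> (\<forall>e\<in>E. e \<subseteq> V \<and> card e = 2)"

(* The empty graph does not count as connected. *)
definition connected_graph :: "'v set \<Rightarrow> 'v set set \<Rightarrow> bool" where
  "connected_graph V E \<longleftrightarrow>
     V \<noteq> {} \<and> (\<forall>u\<in>V. \<forall>v\<in>V. (u, v) \<in> {(x, y). {x, y} \<in> E}\<^sup>*)"

definition incident_edges :: "'v set set \<Rightarrow> 'v \<Rightarrow> 'v set set" where
  "incident_edges E v = {e \<in> E. v \<in> e}"

definition cycle_edges :: "'v list \<Rightarrow> 'v set set" where
  "cycle_edges vs = {{vs ! i, vs ! (Suc i mod length vs)} | i. i < length vs}"

(* A cycle is given by its distinct vertices in cyclic order; as length vs \<ge> 3,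
   it has exactly length vs edges. *)
definition graph_cycle :: "'v set set \<Rightarrow> 'v list \<Rightarrow> bool" where
  "graph_cycle E vs \<longleftrightarrow> length vs \<ge> 3 \<and> distinct vs \<and> cycle_edges vs \<subseteq> E"

definition planar_embedding ::
  "'v set \<Rightarrow> 'v set set \<Rightarrow> ('v \<Rightarrow> real^2) \<Rightarrow> ('v set \<Rightarrow> (real^2) set) \<Rightarrow> bool" where
  "planar_embedding V E pos A \<longleftrightarrow>
     inj_on pos V \<and>
     (\<forall>e\<in>E. \<exists>g. arc g \<and> path_image g = A e \<and> {pathstart g, pathfinish g} = pos ` e) \<and>
     (\<forall>e\<in>E. A e \<inter> pos ` V = pos ` e) \<and>
     (\<forall>e\<in>E. \<forall>e'\<in>E. e \<noteq> e' \<longrightarrow> A e \<inter> A e' = pos ` (e \<inter> e'))"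

definition carrier_set :: "('v, 'z) embedded_metric_graph_scheme \<Rightarrow> (real^2) set" where
  "carrier_set G = vpos G ` vertices G \<union> (\<Union>e\<in>edges G. earc G e)"

definition tiles :: "('v, 'z) embedded_metric_graph_scheme \<Rightarrow> (real^2) set set" where
  "tiles G = closure ` components (- carrier_set G)"

definition closed_topological_disc :: "(real^2) set \<Rightarrow> bool" where
  "closed_topological_disc T \<longleftrightarrow>
     (\<exists>h k. homeomorphism (UNIV :: (real^2) set) (UNIV :: (real^2) set) h k \<and> T = h ` cball 0 1)"

definition finite_tessellating_metric_graph ::
  "('v, 'z) embedded_metric_graph_scheme \<Rightarrow> bool" where
  "finite_tessellating_metric_graph G \<longleftrightarrow>
     finite (vertices G) \<and> finite (edges G) \<and>
     simple_graph (vertices G) (edges G) \<and>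
     connected_graph (vertices G) (edges G) \<and>
     planar_embedding (vertices G) (edges G) (vpos G) (earc G) \<and>
     (\<forall>K. compact K \<longrightarrow> finite {T \<in> tiles G. K \<inter> T \<noteq> {}}) \<and>
     (\<forall>T\<in>tiles G. bounded T \<longrightarrow>
        closed_topological_disc T \<and>
        (\<exists>vs. graph_cycle (edges G) vs \<and> frontier T = (\<Union>e\<in>cycle_edges vs. earc G e))) \<and>
     (\<forall>e\<in>edges G. card {T \<in> tiles G. earc G e \<subseteq> frontier T} = 2) \<and>
     (\<forall>v\<in>vertices G. card (incident_edges (edges G) v) \<ge> 3) \<and>
     (\<forall>e\<in>edges G. elen G e > 0)"

definition vertex_weight :: "('v, 'z) embedded_metric_graph_scheme \<Rightarrow> 'v \<Rightarrow> real" where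
  "vertex_weight G v = (\<Sum>e\<in>incident_edges (edges G) v. elen G e)"

definition boundary_edges ::
  "('v, 'z) embedded_metric_graph_scheme \<Rightarrow> (real^2) set \<Rightarrow> 'v set set" where
  "boundary_edges G T = {e \<in> edges G. earc G e \<subseteq> frontier T}"

definition perimeter ::
  "('v, 'z) embedded_metric_graph_scheme \<Rightarrow> (real^2) set \<Rightarrow> ereal" where
  "perimeter G T = (if bounded T then ereal (\<Sum>e\<in>boundary_edges G T. elen G e) else \<infinity>)"

(* In ereal, 1 / \<infinity> = 0, so the unbounded tile contributes 0. *)
definition characteristic_value ::
  "('v, 'z) embedded_metric_graph_scheme \<Rightarrow> 'v set \<Rightarrow> real" where
  "characteristic_value G e =
     1 / elen G e
     - (\<Sum>v\<in>e. 1 / vertex_weight G v)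
     - (\<Sum>T\<in>{T \<in> tiles G. earc G e \<subseteq> frontier T}. real_of_ereal (1 / perimeter G T))"

end

(* Writing -c(e)|e| = sum_(v in e) |e|/m(v) + sum_(T at e) |e|/p(T) - 1 and exchanging the order of
   summation, every vertex and every bounded tile contributes exactly 1, so the claim is Euler's
   formula V - E + F = 2 with the unbounded face left out.  Euler's formula is proved topologically
   by growing a connected subgraph one edge at a time from a single vertex.  Janiszewski's theorem
   describes the effect of a new arc on the complement: an arc attached at one endpoint does not
   change the number of components, and an arc attached at both endpoints splits exactly one
   component in two. *)

theory Submission
  imports Defs
begin

section \<open>Components of the complement of a union of two plane sets\<close>

text \<open>Two points of \<open>C \<inter> D\<close> are separated neither by \<open>K\<close> nor
  by \<open>J\<close>, so by Janiszewski's theorem not by \<open>K \<union> J\<close> either. A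
  connected set joining them off \<open>K \<union> J\<close> stays in both \<open>C\<close> and
  \<open>D\<close> by maximality of components.\<close>

lemma connected_Int_components_Compl:
  fixes K J :: "complex set"
  assumes "compact K" "closed J" "connected (K \<inter> J)"
    and C: "C \<in> components (- K)" and D: "D \<in> components (- J)"
  shows "connected (C \<inter> D)"
  unfolding connected_iff_connected_component
proof (intro ballI)
  fix p q assume p: "p \<in> C \<inter> D" and q: "q \<in> C \<inter> D"
  have "connected_component (- K) p q" "connected_component (- J) p q"
    using C D p q by (meson IntD1 IntD2 connected_component_def in_components_connected in_components_subset)+
  then have "connected_component (- (K \<union> J)) p q"
    using Janiszewski assms by blast
  then obtain T where T: "connected T" "T \<subseteq> - (K \<union> J)" "p \<in> T" "q \<in> T"
    by (auto simp: connected_component_def)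
  then have "T \<subseteq> C" "T \<subseteq> D"
    using components_maximal[OF C, of T] components_maximal[OF D, of T] p by auto
  with T show "connected_component (C \<inter> D) p q"
    by (auto simp: connected_component_def)
qed

text \<open>A component of the smaller complement lies in some \<open>C\<close> and some
  \<open>D\<close>, and since \<open>C \<inter> D\<close> is connected it must fill it. Counting
  faces after an addition thus reduces to counting nonempty intersections.\<close>

lemma components_Compl_Un:
  fixes K J :: "complex set"
  assumes "compact K" "closed J" "connected (K \<inter> J)"
  shows "components (- (K \<union> J)) =
    {C \<inter> D |C D. C \<in> components (- K) \<and> D \<in> components (- J) \<and> C \<inter> D \<noteq> {}}"
    (is "?L = ?R")
proof
  show "?L \<subseteq> ?R"
  proof
    fix B assume B: "B \<in> ?L"
    then have B': "B \<noteq> {}" "connected B" "B \<subseteq> - K" "B \<subseteq> - J"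
      using in_components_nonempty in_components_connected in_components_subset by blast+
    then obtain C where C: "C \<in> components (- K)" "B \<subseteq> C"
      using exists_component_superset[of B "- K"] by blast
    obtain D where D: "D \<in> components (- J)" "B \<subseteq> D"
      using exists_component_superset[of B "- J"] B' by blast
    have "C \<inter> D \<subseteq> - (K \<union> J)"
      using C D in_components_subset by blast
    then have "C \<inter> D \<subseteq> B"
      using components_maximal[OF B] connected_Int_components_Compl[OF assms C(1) D(1)] C D B' by blast
    then have "B = C \<inter> D"
      using C D by blast
    then show "B \<in> ?R"
      using C D B' by blast
  qed
next
  show "?R \<subseteq> ?L"
  proof clarify
    fix C D assume C: "C \<in> components (- K)" and D: "D \<in> components (- J)" and ne: "C \<inter> D \<noteq> {}"
    have "C \<inter> D \<subseteq> - (K \<union> J)"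
      using C D in_components_subset by blast
    then obtain B where B: "B \<in> components (- (K \<union> J))" "C \<inter> D \<subseteq> B"
      using exists_component_superset[of "C \<inter> D" "- (K \<union> J)"] ne
        connected_Int_components_Compl[OF assms C D] by blast
    then have B': "connected B" "B \<subseteq> - K" "B \<subseteq> - J"
      using in_components_connected in_components_subset by blast+
    have "B \<subseteq> C" "B \<subseteq> D"
      using components_maximal[OF C B'(1,2)] components_maximal[OF D B'(1,3)] B(2) ne by blast+
    with B show "C \<inter> D \<in> ?L"
      by (metis Int_greatest subset_antisym)
  qed
qed

section \<open>The effect of one new arc on the faces\<close>

text \<open>The inverse of the arc would embed a nonempty open set of dimension at least 2 into the
  real line, against invariance of dimension. It ensures that deleting an arc never exhausts a
  face.\<close>

lemma open_arc_image_empty: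
  fixes g :: "real \<Rightarrow> 'a::euclidean_space"
  assumes "arc g" "open U" "U \<subseteq> path_image g" "2 \<le> DIM('a)"
  shows "U = {}"
proof (rule ccontr)
  assume "U \<noteq> {}"
  obtain h where h: "homeomorphism {0..1} (path_image g) g h"
    using homeomorphism_arc[OF \<open>arc g\<close>] .
  have "continuous_on U h"
    using h assms(3) continuous_on_subset homeomorphism_cont2 by blast
  moreover have "inj_on h U"
    using h assms(3) by (intro inj_on_inverseI[of U g]) (auto simp: homeomorphism_def)
  ultimately have "DIM('a) \<le> DIM(real)"
    using invariance_of_dimension \<open>open U\<close> \<open>U \<noteq> {}\<close> by blast
  with assms(4) show False by simp
qed

text \<open>A single point is connected, so Janiszewski's theorem applies to the arc itself. The
  complement of an arc is connected, hence every old face is only intersected with that one set and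
  survives as one face.\<close>

lemma components_Compl_pendant_arc:
  fixes K :: "complex set"
  assumes "compact K" "arc g" "K \<inter> path_image g = {a}"
  shows "bij_betw (\<lambda>C. C - path_image g) (components (- K)) (components (- (K \<union> path_image g)))"
proof -
  let ?A = "path_image g"
  have cl: "closed ?A"
    using assms(2) closed_arc_image by blast
  have open_C: "open C" if "C \<in> components (- K)" for C
    using that assms(1) compact_imp_closed open_components open_Compl by blast
  have ne: "C - ?A \<noteq> {}" if "C \<in> components (- K)" for C
    using open_arc_image_empty[OF assms(2) open_C[OF that]] in_components_nonempty[OF that] by auto
  have "connected (- ?A)"
    by (simp add: assms(2) path_connected_arc_complement path_connected_imp_connected)
  moreover have "- ?A \<noteq> {}"
    using open_arc_image_empty[OF assms(2), of UNIV] by auto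
  ultimately have comps_A: "components (- ?A) = {- ?A}"
    by (simp add: components_eq_sing_iff)
  have "connected (K \<inter> ?A)"
    unfolding assms(3) by simp
  note comps = components_Compl_Un[OF assms(1) cl this, unfolded comps_A]
  have "components (- (K \<union> ?A)) = (\<lambda>C. C - ?A) ` components (- K)"
  proof (intro subset_antisym subsetI)
    fix B assume "B \<in> components (- (K \<union> ?A))"
    then obtain C where "C \<in> components (- K)" "B = C \<inter> - ?A"
      unfolding comps by blast
    then show "B \<in> (\<lambda>C. C - ?A) ` components (- K)"
      by (simp add: Diff_eq)
  next
    fix B assume "B \<in> (\<lambda>C. C - ?A) ` components (- K)"
    then obtain C where C: "C \<in> components (- K)" "B = C \<inter> - ?A"
      by (auto simp: Diff_eq)
    then have "C \<inter> - ?A \<noteq> {}"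
      using ne[OF C(1)] by (simp add: Diff_eq)
    with C show "B \<in> components (- (K \<union> ?A))"
      unfolding comps by blast
  qed
  moreover have "inj_on (\<lambda>C. C - ?A) (components (- K))"
  proof (rule inj_onI)
    fix C D assume C: "C \<in> components (- K)" and D: "D \<in> components (- K)" and "C - ?A = D - ?A"
    then have "C \<inter> D \<noteq> {}"
      using ne[OF C] by blast
    then show "C = D"
      using components_eq[OF C D] by blast
  qed
  ultimately show ?thesis
    by (simp add: bij_betw_def)
qed

text \<open>The arc meets \<open>K\<close> in two points, a disconnected set, which rules out the
  argument for pendant arcs; path-connectedness of \<open>K\<close> supplies a way back from one end
  to the other. That \<open>I\<close> and \<open>W\<close> are distinct and not among the old
  components makes the count exact: one face lost, two gained.\<close>

lemma components_Compl_chord: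
  fixes K :: "complex set"
  assumes K: "compact K" "path_connected K" and g: "arc g"
    and int: "K \<inter> path_image g = {pathstart g, pathfinish g}"
  obtains C I W where "C \<in> components (- K)" "I \<noteq> W"
    "I \<notin> components (- K)" "W \<notin> components (- K)"
    "components (- (K \<union> path_image g)) = components (- K) - {C} \<union> {I, W}"
proof -
  let ?A = "path_image g" and ?a = "pathstart g" and ?b = "pathfinish g"
  have "?a \<in> K" "?b \<in> K" "?a \<noteq> ?b"
    using int arc_distinct_ends[OF g] by auto
  then obtain h where h: "arc h" "path_image h \<subseteq> K" "pathstart h = ?b" "pathfinish h = ?a"
    using K(2) unfolding path_connected_arcwise by metis
  \<comment> \<open>The new arc is closed up to a Jordan curve J through K: adding J to K is the same as adding
    the arc, and unlike the arc, J meets K in a connected set, as Janiszewski's theorem requires.\<close>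
  define J where "J = path_image (g +++ h)"
  have J: "J = ?A \<union> path_image h"
    by (simp add: J_def path_image_join h)
  have "simple_path (g +++ h)"
    using g h int by (intro simple_path_join_loop) auto
  moreover have "pathfinish (g +++ h) = pathstart (g +++ h)"
    by (simp add: h)
  ultimately obtain I W where IW: "I \<noteq> {}" "open I" "connected I" "W \<noteq> {}" "open W" "connected W"
    "I \<inter> W = {}" "I \<union> W = - J" "frontier I = J" "frontier W = J"
    unfolding J_def by (rule Jordan_curve)
  \<comment> \<open>\<open>I\<close> and \<open>W\<close> are disjoint open sets covering
    \<open>- J\<close>, so a connected set off the curve cannot meet both.\<close>
  have sides: "X \<subseteq> I \<or> X \<subseteq> W" if "connected X" "X \<subseteq> - J" for X
    using connectedD[OF that(1) IW(2,5)] IW(7,8) that(2) by blast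
  have compI: "components (- J) = {I, W}"
  proof (intro subset_antisym subsetI)
    fix D assume D: "D \<in> components (- J)"
    then have "D \<subseteq> I \<or> D \<subseteq> W"
      using sides in_components_connected in_components_subset by blast
    moreover have "I \<subseteq> D" if "D \<subseteq> I"
      using components_maximal[OF D IW(3)] in_components_nonempty[OF D] that IW(8) by blast
    moreover have "W \<subseteq> D" if "D \<subseteq> W"
      using components_maximal[OF D IW(6)] in_components_nonempty[OF D] that IW(8) by blast
    ultimately show "D \<in> {I, W}" by blast
  next
    fix D assume D: "D \<in> {I, W}"
    then obtain D' where D': "D' \<in> components (- J)" "D \<subseteq> D'"
      using exists_component_superset[of D "- J"] IW by blast
    then have "D' \<subseteq> I \<or> D' \<subseteq> W"
      using sides in_components_connected in_components_subset by blast
    then have "D' = D"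
      using D D' IW by blast
    with D' show "D \<in> components (- J)" by simp
  qed
  have "closed J"
    using IW(9) frontier_closed by blast
  have "{?a, ?b} \<subseteq> path_image h"
    using h pathstart_in_path_image[of h] pathfinish_in_path_image[of h] by simp
  then have "K \<inter> J = path_image h"
    using h(2) int J by blast
  then have "connected (K \<inter> J)"
    using h connected_arc_image by simp
  have KJ: "K \<union> J = K \<union> ?A"
    using h J by auto
  \<comment> \<open>The arc without its ends is connected and avoids \<open>K\<close>, so it selects
    the one face \<open>C\<close> that gets split.\<close>
  let ?M = "?A - {?a, ?b}"
  have A0: "connected ?M" "?M \<noteq> {}" "?M \<subseteq> - K"
    using connected_simple_path_endless[of g] nonempty_simple_path_endless[of g]
      arc_imp_simple_path[OF g] int by auto
  then obtain C where C: "C \<in> components (- K)" "?M \<subseteq> C"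
    using exists_component_superset[of ?M "- K"] by blast
  have "open C"
    using C K(1) compact_imp_closed open_components open_Compl by blast
  obtain x where x: "x \<in> C" "x \<in> J"
    using A0 C(2) J by blast
  \<comment> \<open>Every point of a Jordan curve is a frontier point of both sides; hence the open
    set \<open>C\<close> around \<open>x\<close> meets both, and both pieces of \<open>C\<close> are
    nonempty.\<close>
  have "x \<in> closure I" "x \<in> closure W"
    using x(2) IW(9,10) by (metis DiffD1 frontier_def)+
  then have "C \<inter> I \<noteq> {}" "C \<inter> W \<noteq> {}"
    using x(1) \<open>open C\<close> open_Int_closure_eq_empty[of C] by blast+
  \<comment> \<open>\<open>J\<close> lies in \<open>K \<union> C\<close>, so any other face misses
    the curve, falls on one side of it and remains unchanged.\<close>
  have other: "C' \<subseteq> - J" if "C' \<in> components (- K)" "C' \<noteq> C" for C'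
  proof -
    have "C' \<inter> C = {}" "C' \<subseteq> - K"
      using that(2) components_nonoverlap[OF that(1) C(1)] in_components_subset[OF that(1)] by auto
    moreover have "J \<subseteq> K \<union> C"
      using J h(2) C(2) \<open>?a \<in> K\<close> \<open>?b \<in> K\<close> by blast
    ultimately show ?thesis by blast
  qed
  have "components (- (K \<union> ?A)) = components (- K) - {C} \<union> {C \<inter> I, C \<inter> W}" (is "?L = ?R")
  proof -
    have L: "?L = {C' \<inter> D |C' D. C' \<in> components (- K) \<and> D \<in> {I, W} \<and> C' \<inter> D \<noteq> {}}"
      using components_Compl_Un[OF K(1) \<open>closed J\<close> \<open>connected (K \<inter> J)\<close>] KJ compI by simp
    have *: "(C' \<subseteq> I \<and> C' \<inter> W = {} \<or> C' \<subseteq> W \<and> C' \<inter> I = {}) \<and> C' \<noteq> {}"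
      if "C' \<in> components (- K)" "C' \<noteq> C" for C'
      using sides[of C'] other[OF that] in_components_connected[OF that(1)]
        in_components_nonempty[OF that(1)] IW(7) by blast
    show ?thesis
    proof (intro subset_antisym subsetI)
      fix B assume "B \<in> ?L"
      then obtain C' D where B: "B = C' \<inter> D" "C' \<in> components (- K)" "D \<in> {I, W}" "C' \<inter> D \<noteq> {}"
        unfolding L by blast
      show "B \<in> ?R"
      proof (cases "C' = C")
        case True then show ?thesis using B by blast
      next
        case False
        then have "B = C'" using *[OF B(2)] B by blast
        then show ?thesis using False B(2) by blast
      qed
    next
      fix B assume "B \<in> ?R"
      then consider "B \<in> components (- K)" "B \<noteq> C" | "B = C \<inter> I" | "B = C \<inter> W" by blast
      then show "B \<in> ?L"
      proof cases
        case 1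
        then have "B = B \<inter> I \<or> B = B \<inter> W" "B \<noteq> {}" using *[OF 1] by blast+
        then show ?thesis unfolding L using 1(1) by blast
      next
        case 2
        then show ?thesis unfolding L using C(1) \<open>C \<inter> I \<noteq> {}\<close> by blast
      next
        case 3
        then show ?thesis unfolding L using C(1) \<open>C \<inter> W \<noteq> {}\<close> by blast
      qed
    qed
  qed
  \<comment> \<open>An old component meeting \<open>C\<close> equals \<open>C\<close> and so
    contains \<open>x\<close>, whereas neither piece does: both pieces are new.\<close>
  moreover have "x \<notin> I" "x \<notin> W" using x IW(8) by blast+
  then have "C \<inter> I \<notin> components (- K)" "C \<inter> W \<notin> components (- K)"
    using components_eq[OF C(1)] x \<open>C \<inter> I \<noteq> {}\<close> \<open>C \<inter> W \<noteq> {}\<close> by blast+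
  moreover have "C \<inter> I \<noteq> C \<inter> W"
    using IW(7) \<open>C \<inter> I \<noteq> {}\<close> by blast
  ultimately show thesis
    using that C(1) by metis
qed

section \<open>Euler's formula for planar embeddings\<close>

lemma components_homeomorphism:
  assumes "homeomorphism S T f g"
  shows "components T = (image f) ` components S"
proof -
  have "T = f ` S"
    using assms by (simp add: homeomorphism_image1)
  then show ?thesis
    unfolding components_def image_image
    using connected_component_set_homeomorphism[OF assms] by (simp add: image_image)
qed

lemma card_components_Compl_homeomorphic_image:
  assumes "homeomorphism UNIV UNIV f g"
  shows "finite (components (- f ` S)) \<longleftrightarrow> finite (components (- S))"
    and "card (components (- f ` S)) = card (components (- S))"
proof -
  have "bij f"
    using assms by (metis bijI' homeomorphism_def UNIV_I)
  then have "homeomorphism (- S) (- f ` S) f g"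
    using assms by (metis bij_image_Compl_eq homeomorphism_of_subsets subset_UNIV)
  then have "components (- f ` S) = (image f) ` components (- S)"
    by (rule components_homeomorphism)
  moreover have "inj_on (image f) (components (- S))"
    using \<open>bij f\<close> by (meson bij_def inj_on_image inj_on_subset subset_UNIV)
  ultimately show "finite (components (- f ` S)) \<longleftrightarrow> finite (components (- S))"
    "card (components (- f ` S)) = card (components (- S))"
    by (simp_all add: finite_image_iff card_image)
qed

text \<open>Stated over \<open>complex\<close>, where Janiszewski's theorem and the Jordan curve
  theorem are available.\<close>

lemma euler_formula_complex:
  fixes pos :: "'v \<Rightarrow> complex" and A :: "'v set \<Rightarrow> complex set"
  assumes fin: "finite V" "finite E" and simple: "simple_graph V E" and conn: "connected_graph V E"
    and inj: "inj_on pos V"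
    and arcs: "\<And>e. e \<in> E \<Longrightarrow> \<exists>g. arc g \<and> path_image g = A e \<and> {pathstart g, pathfinish g} = pos ` e"
    and A_pos: "\<And>e. e \<in> E \<Longrightarrow> A e \<inter> pos ` V = pos ` e"
    and A_A: "\<And>e e'. \<lbrakk>e \<in> E; e' \<in> E; e \<noteq> e'\<rbrakk> \<Longrightarrow> A e \<inter> A e' = pos ` (e \<inter> e')"
  shows "finite (components (- (pos ` V \<union> \<Union> (A ` E))))"
    and "card (components (- (pos ` V \<union> \<Union> (A ` E)))) + card V = card E + 2"
proof -
  define X where "X V' E' = pos ` V' \<union> \<Union> (A ` E')" for V' E'
  \<comment> \<open>The invariant of the growing subgraph. Besides Euler's formula it carries
    path-connectedness of the drawing, needed when a chord is added, and finiteness of the set of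
    faces, which gives \<open>card\<close> its meaning.\<close>
  define P where "P V' E' \<longleftrightarrow> V' \<noteq> {} \<and> V' \<subseteq> V \<and> E' \<subseteq> E \<and> \<Union>E' \<subseteq> V' \<and> path_connected (X V' E') \<and>
    finite (components (- X V' E')) \<and> card (components (- X V' E')) + card V' = card E' + 2" for V' E'
  have edge: "\<exists>u w. e = {u, w} \<and> u \<noteq> w" if "e \<in> E" for e
    using simple that by (auto simp: simple_graph_def card_2_iff)
  have compact_X: "compact (X V' E')" if "V' \<subseteq> V" "E' \<subseteq> E" for V' E'
  proof -
    have "compact (A e)" if "e \<in> E" for e
      using arcs[OF that] compact_arc_image by metis
    then show ?thesis
      unfolding X_def using that fin
      by (intro compact_Un[OF finite_imp_compact compact_UN]) (auto intro: finite_subset)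
  qed
  have crossing: "\<exists>e\<in>E - E'. e \<inter> V' \<noteq> {}" if "P V' E'" "(V', E') \<noteq> (V, E)" for V' E'
  proof (rule ccontr)
    assume no: "\<not> (\<exists>e\<in>E - E'. e \<inter> V' \<noteq> {})"
    have sub: "V' \<noteq> {}" "V' \<subseteq> V" "E' \<subseteq> E" "\<Union>E' \<subseteq> V'"
      using that(1) by (auto simp: P_def)
    then obtain u where u: "u \<in> V'" by blast
    have "w \<in> V'" if "w \<in> V" for w
    proof -
      have "(u, w) \<in> {(x, y). {x, y} \<in> E}\<^sup>*"
        using conn u sub that by (auto simp: connected_graph_def)
      then show ?thesis
      proof (induction rule: rtrancl_induct)
        case (step y z)
        then have "{y, z} \<in> E" "{y, z} \<inter> V' \<noteq> {}"
          by auto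
        then have "{y, z} \<in> E'"
          using no by blast
        then show ?case
          using sub(4) by blast
      qed (rule u)
    qed
    then have "V' = V" using sub by blast
    have "e \<in> E'" if "e \<in> E" for e
    proof -
      have "e \<subseteq> V'" "e \<noteq> {}"
        using edge[OF that] simple that \<open>V' = V\<close> by (auto simp: simple_graph_def)
      then show ?thesis
        using no that by blast
    qed
    with \<open>V' = V\<close> sub that(2) show False by blast
  qed
  have extend: "\<exists>V'' E''. P V'' E'' \<and> card E'' = Suc (card E')" if P: "P V' E'" "(V', E') \<noteq> (V, E)" for V' E'
  proof -
    obtain e where e: "e \<in> E" "e \<notin> E'" "e \<inter> V' \<noteq> {}"
      using crossing[OF P] by blast
    then obtain u w where uw: "e = {u, w}" "u \<noteq> w" "u \<in> V'"
      using edge[OF e(1)] by blast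
    obtain g where g: "arc g" "path_image g = A e" "{pathstart g, pathfinish g} = pos ` e"
      using arcs[OF e(1)] by blast
    have sub: "V' \<noteq> {}" "V' \<subseteq> V" "E' \<subseteq> E" "\<Union>E' \<subseteq> V'" "path_connected (X V' E')"
      "finite (components (- X V' E'))" "card (components (- X V' E')) + card V' = card E' + 2"
      using P(1) by (auto simp: P_def)
    have "e \<subseteq> V" using simple e by (auto simp: simple_graph_def)
    have fin': "finite V'" "finite E'" using sub fin finite_subset by blast+
    \<comment> \<open>The new arc can touch the old drawing only at its endpoints in
      \<open>V'\<close>: injectivity of \<open>pos\<close> handles isolated points, and
      \<open>\<Union>E' \<subseteq> V'\<close> handles the old arcs.\<close>
    have "A e \<inter> pos ` V' = pos ` (e \<inter> V')"
      using A_pos[OF e(1)] inj sub \<open>e \<subseteq> V\<close> unfolding inj_on_def by blast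
    moreover have "A e \<inter> A e' \<subseteq> pos ` (e \<inter> V')" if "e' \<in> E'" for e'
      using A_A[of e e'] e that sub by blast
    ultimately have meet: "X V' E' \<inter> A e = pos ` (e \<inter> V')"
      unfolding X_def by blast
    have "path_connected (A e)"
      using g(1,2) path_connected_path_image arc_imp_path by metis
    moreover have "X V' E' \<inter> A e \<noteq> {}"
      using meet e(3) by blast
    ultimately have pc: "path_connected (X V' E' \<union> A e)"
      using sub(5) path_connected_Un by blast
    have pos_e: "pos ` e \<subseteq> A e"
      using A_pos[OF e(1)] by blast
    have X': "X (V' \<union> e) (insert e E') = X V' E' \<union> A e"
      unfolding X_def using pos_e by blast
    have card_E: "card (insert e E') = Suc (card E')"
      using fin' e(2) by simp
    have "finite (components (- (X V' E' \<union> A e))) \<and>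
      card (components (- (X V' E' \<union> A e))) + card (V' \<union> e) = Suc (card E') + 2"
    \<comment> \<open>The extra edge is balanced by an extra face if both ends were present, and by
      the extra vertex \<open>w\<close> otherwise.\<close>
    proof (cases "w \<in> V'")
      case True
      then have "e \<inter> V' = e" "V' \<union> e = V'" using uw by auto
      then have "X V' E' \<inter> path_image g = {pathstart g, pathfinish g}"
        using meet g by simp
      then obtain C I W where CIW: "C \<in> components (- X V' E')" "I \<noteq> W"
          "I \<notin> components (- X V' E')" "W \<notin> components (- X V' E')"
          "components (- (X V' E' \<union> path_image g)) = components (- X V' E') - {C} \<union> {I, W}"
        using components_Compl_chord[OF compact_X[OF sub(2,3)] sub(5) g(1)] by metis
      have "card (components (- (X V' E' \<union> A e))) = card (components (- X V' E') - {C}) + 2"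
        using CIW sub(6) g(2) by (simp add: card_insert_if)
      also have "\<dots> = Suc (card (components (- X V' E')))"
        using CIW(1) sub(6) by (simp add: card_gt_0_iff)
           (metis Suc_pred card_gt_0_iff empty_iff)
      finally show ?thesis
        using CIW sub(6,7) g(2) \<open>V' \<union> e = V'\<close> by simp
    next
      case False
      then have "e \<inter> V' = {u}" "V' \<union> e = insert w V'" using uw by auto
      then have "X V' E' \<inter> path_image g = {pos u}"
        using meet g by simp
      from components_Compl_pendant_arc[OF compact_X[OF sub(2,3)] g(1) this]
      show ?thesis
        using sub(6,7) g(2) False fin' \<open>V' \<union> e = insert w V'\<close>
        by (metis (no_types, lifting) bij_betw_finite bij_betw_same_card card_insert_disjoint add_Suc_right add_Suc)
    qed
    then have "P (V' \<union> e) (insert e E')"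
      unfolding P_def X' card_E using sub \<open>e \<subseteq> V\<close> e(1) pc by auto
    with card_E show ?thesis by blast
  qed
  have start: "\<exists>V'. P V' {}"
  proof -
    obtain v where "v \<in> V" using conn by (auto simp: connected_graph_def)
    have "connected (- {pos v})"
      using connected_punctured_universe[of "pos v"] by (simp add: Compl_eq_Diff_UNIV)
    moreover have "- {pos v} \<noteq> {}"
      by (metis Compl_UNIV_eq UNIV_I double_compl finite.emptyI finite.insertI infinite_UNIV_char_0)
    ultimately have "components (- {pos v}) = {- {pos v}}"
      by (simp add: components_eq_sing_iff)
    \<comment> \<open>The punctured plane is connected: one face and one vertex against no edges,
      \<open>1 + 1 = 0 + 2\<close>.\<close>
    then have "P {v} {}"
      unfolding P_def X_def using \<open>v \<in> V\<close> by simp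
    then show ?thesis ..
  qed
  have "P V E"
  proof (rule ccontr)
    assume "\<not> P V E"
    \<comment> \<open>If the full graph violated the invariant, extension would never be blocked,
      and subgraphs with more than \<open>card E\<close> edges would arise.\<close>
    then have "\<exists>V' E'. P V' E' \<and> card E' = n" for n
      by (induction n) (use start extend in \<open>force, metis prod.inject\<close>)
    then obtain V' E' where "P V' E'" "card E' = Suc (card E)" by blast
    moreover have "card E' \<le> card E"
      using \<open>P V' E'\<close> fin(2) by (auto simp: P_def intro: card_mono)
    ultimately show False by simp
  qed
  then show "finite (components (- (pos ` V \<union> \<Union> (A ` E))))"
    "card (components (- (pos ` V \<union> \<Union> (A ` E)))) + card V = card E + 2"
    by (simp_all add: P_def X_def)
qed

text \<open>A linear isomorphism from \<open>real^2\<close> to \<open>complex\<close> carries the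
  whole drawing over, and as a homeomorphism it preserves the number of faces.\<close>

lemma euler_formula_planar_embedding:
  fixes pos :: "'v \<Rightarrow> real^2" and A :: "'v set \<Rightarrow> (real^2) set"
  assumes fin: "finite V" "finite E" and graph: "simple_graph V E" "connected_graph V E"
    and emb: "planar_embedding V E pos A"
  shows "finite (components (- (pos ` V \<union> \<Union> (A ` E))))"
    and "card (components (- (pos ` V \<union> \<Union> (A ` E)))) + card V = card E + 2"
proof -
  obtain f :: "real^2 \<Rightarrow> complex" and h where f: "linear f" "linear h"
      "\<And>x. h (f x) = x" "\<And>y. f (h y) = y"
    by (rule isomorphisms_UNIV_UNIV[where 'M = "real^2" and 'N = complex]) auto
  have "inj f" by (metis f(3) injI)
  have hom: "homeomorphism UNIV UNIV f h"
    using f by (intro homeomorphismI) (auto simp: linear_continuous_on linear_linear)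
  let ?X = "pos ` V \<union> \<Union> (A ` E)"
  have X: "f ` ?X = (f \<circ> pos) ` V \<union> \<Union> ((\<lambda>e. f ` A e) ` E)"
    by (simp add: image_Un image_UN image_comp)
  have "inj_on (f \<circ> pos) V"
    using emb \<open>inj f\<close> by (auto simp: planar_embedding_def intro: comp_inj_on inj_on_subset)
  moreover have "\<exists>g. arc g \<and> path_image g = f ` A e \<and> {pathstart g, pathfinish g} = (f \<circ> pos) ` e"
    if "e \<in> E" for e
  proof -
    obtain g where g: "arc g" "path_image g = A e" "{pathstart g, pathfinish g} = pos ` e"
      using emb \<open>e \<in> E\<close> unfolding planar_embedding_def by metis
    have "{pathstart (f \<circ> g), pathfinish (f \<circ> g)} = f ` {pathstart g, pathfinish g}"
      by (simp add: pathstart_compose pathfinish_compose)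
    then have "arc (f \<circ> g) \<and> path_image (f \<circ> g) = f ` A e \<and>
        {pathstart (f \<circ> g), pathfinish (f \<circ> g)} = (f \<circ> pos) ` e"
      using g arc_linear_image_eq[OF f(1) \<open>inj f\<close>] by (simp add: path_image_compose image_comp)
    then show ?thesis by blast
  qed
  moreover have "f ` A e \<inter> (f \<circ> pos) ` V = (f \<circ> pos) ` e" if "e \<in> E" for e
  proof -
    have "A e \<inter> pos ` V = pos ` e"
      using emb that by (simp add: planar_embedding_def)
    then show ?thesis
      using image_Int[OF \<open>inj f\<close>, of "A e" "pos ` V"] by (simp add: image_comp)
  qed
  moreover have "f ` A e \<inter> f ` A e' = (f \<circ> pos) ` (e \<inter> e')"
    if "e \<in> E" "e' \<in> E" "e \<noteq> e'" for e e'
  proof -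
    have "A e \<inter> A e' = pos ` (e \<inter> e')"
      using emb that by (simp add: planar_embedding_def)
    then show ?thesis
      using image_Int[OF \<open>inj f\<close>, of "A e" "A e'"] by (simp add: image_comp)
  qed
  ultimately have "finite (components (- f ` ?X))" "card (components (- f ` ?X)) + card V = card E + 2"
    unfolding X using euler_formula_complex[OF fin graph, of "f \<circ> pos" "\<lambda>e. f ` A e"] by blast+
  then show "finite (components (- ?X))" "card (components (- ?X)) + card V = card E + 2"
    by (simp_all add: card_components_Compl_homeomorphic_image[OF hom])
qed

section \<open>From faces to bounded tiles\<close>

lemma bounded_closure_iff: "bounded (closure S) \<longleftrightarrow> bounded S"
  by (meson bounded_closure bounded_subset closure_subset)

text \<open>An open component that meets the closure of another meets that component itself. Hence
  passing from faces to tiles, which are closures, loses none in the count.\<close>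

lemma inj_on_closure_components:
  fixes S :: "'a::real_normed_vector set"
  assumes "open S"
  shows "inj_on closure (components S)"
proof (rule inj_onI)
  fix C D assume C: "C \<in> components S" and D: "D \<in> components S" and eq: "closure C = closure D"
  have "C \<inter> closure D \<noteq> {}"
    using closure_subset[of C] in_components_nonempty[OF C] eq by auto
  then have "C \<inter> D \<noteq> {}"
    using open_Int_closure_eq_empty[OF open_components[OF assms C]] by blast
  then show "C = D"
    using components_eq C D by blast
qed

text \<open>The drawing is compact, so exactly one component of its complement is unbounded;
  removing it lowers the constant in Euler's formula from 2 to 1.\<close>

lemma card_bounded_tiles:
  fixes G :: "('v, 'z) embedded_metric_graph_scheme"
  assumes "finite (vertices G)" "finite (edges G)" "simple_graph (vertices G) (edges G)"
    "connected_graph (vertices G) (edges G)"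
    "planar_embedding (vertices G) (edges G) (vpos G) (earc G)"
  shows "finite (tiles G)"
    and "card {T \<in> tiles G. bounded T} + card (vertices G) = card (edges G) + 1"
proof -
  let ?comps = "components (- carrier_set G)"
  have euler: "finite ?comps" "card ?comps + card (vertices G) = card (edges G) + 2"
    using euler_formula_planar_embedding[OF assms] by (simp_all add: carrier_set_def)
  then show "finite (tiles G)"
    by (simp add: tiles_def)
  have "compact (earc G e)" if "e \<in> edges G" for e
    using assms(5) that compact_arc_image unfolding planar_embedding_def by metis
  then have "compact (carrier_set G)"
    unfolding carrier_set_def using assms(1,2)
    by (intro compact_Un[OF finite_imp_compact compact_UN]) auto
  then have X: "open (- carrier_set G)" "bounded (- (- carrier_set G))"
    by (simp_all add: compact_imp_closed compact_imp_bounded open_Compl)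
  obtain U where U: "U \<in> ?comps" "\<not> bounded U"
    using cobounded_unbounded_components[OF X(2)] by blast
  have "C = U" if "C \<in> ?comps" "\<not> bounded C" for C
    using cobounded_unique_unbounded_components[OF X(2) U that] by simp
  then have "{C \<in> ?comps. bounded C} = ?comps - {U}"
    using U(2) by blast
  moreover have "{T \<in> tiles G. bounded T} = closure ` {C \<in> ?comps. bounded C}"
    by (auto simp: tiles_def bounded_closure_iff)
  ultimately have "{T \<in> tiles G. bounded T} = closure ` (?comps - {U})"
    by simp
  moreover have "inj_on closure (?comps - {U})"
    using inj_on_closure_components[OF X(1)] by (rule inj_on_subset) blast
  ultimately have "card {T \<in> tiles G. bounded T} = card ?comps - 1"
    using U euler(1) by (simp add: card_image)
  moreover have "card ?comps > 0"
    using U euler(1) by (auto simp: card_gt_0_iff)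
  ultimately show "card {T \<in> tiles G. bounded T} + card (vertices G) = card (edges G) + 1"
    using euler(2) by linarith
qed

section \<open>Double counting of the characteristic values\<close>

theorem corollary3p9:
  fixes G :: "'v embedded_metric_graph"
  assumes "finite_tessellating_metric_graph G"
  shows "(\<Sum>e\<in>edges G. - characteristic_value G e * elen G e) = 1"
proof -
  let ?V = "vertices G" and ?E = "edges G" and ?l = "elen G"
  let ?BT = "{T \<in> tiles G. bounded T}"
  let ?p = "\<lambda>T. \<Sum>e\<in>boundary_edges G T. ?l e"
  have fin: "finite ?V" "finite ?E" and simple: "simple_graph ?V ?E"
    and graph: "connected_graph ?V ?E" "planar_embedding ?V ?E (vpos G) (earc G)"
    and disc: "\<forall>T\<in>tiles G. bounded T \<longrightarrow> closed_topological_disc T \<and>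
      (\<exists>vs. graph_cycle ?E vs \<and> frontier T = (\<Union>e\<in>cycle_edges vs. earc G e))"
    and deg: "\<forall>v\<in>?V. card (incident_edges ?E v) \<ge> 3"
    and len: "\<forall>e\<in>?E. ?l e > 0"
    using assms unfolding finite_tessellating_metric_graph_def by - (elim conjE, assumption)+
  note tiles = card_bounded_tiles[OF fin simple graph]
  \<comment> \<open>Positivity matters because division by 0 yields 0: a vertex of weight 0 would
    contribute 0 instead of 1. The degree bound excludes this.\<close>
  have vertex_pos: "vertex_weight G v > 0" if "v \<in> ?V" for v
  proof -
    have "incident_edges ?E v \<noteq> {}"
      using deg that by (metis card.empty not_numeral_le_zero)
    then show ?thesis
      unfolding vertex_weight_def
      using len fin(2) by (intro sum_pos) (auto simp: incident_edges_def)
  qed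
  \<comment> \<open>The boundary cycle has at least three vertices, so it provides an edge of
    positive length.\<close>
  have perimeter_pos: "?p T > 0" if "T \<in> ?BT" for T
  proof -
    obtain vs where vs: "graph_cycle ?E vs" "frontier T = (\<Union>e\<in>cycle_edges vs. earc G e)"
      using disc \<open>T \<in> ?BT\<close> by blast
    have "0 < length vs" "cycle_edges vs \<subseteq> ?E"
      using vs(1) by (auto simp: graph_cycle_def)
    then obtain e where "e \<in> cycle_edges vs" "e \<in> ?E"
      unfolding cycle_edges_def by blast
    then have "e \<in> boundary_edges G T"
      using vs(2) by (auto simp: boundary_edges_def)
    then have "boundary_edges G T \<noteq> {}"
      by blast
    then show ?thesis
      using len fin(2) by (intro sum_pos) (auto simp: boundary_edges_def)
  qed
  have vertex_sum: "(\<Sum>e\<in>?E. \<Sum>v\<in>e. ?l e / vertex_weight G v) = card ?V"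
  proof -
    have "(\<Sum>e\<in>?E. \<Sum>v\<in>e. ?l e / vertex_weight G v) =
        (\<Sum>e\<in>?E. \<Sum>v | v \<in> ?V \<and> v \<in> e. ?l e / vertex_weight G v)"
      using simple by (intro sum.cong refl) (auto simp: simple_graph_def)
    also have "\<dots> = (\<Sum>v\<in>?V. \<Sum>e | e \<in> ?E \<and> v \<in> e. ?l e / vertex_weight G v)"
      by (rule sum.swap_restrict[OF fin(2,1)])
    also have "\<dots> = (\<Sum>v\<in>?V. 1)"
    proof (intro sum.cong refl)
      fix v assume "v \<in> ?V"
      then show "(\<Sum>e | e \<in> ?E \<and> v \<in> e. ?l e / vertex_weight G v) = 1"
        using vertex_pos[of v] by (simp add: vertex_weight_def incident_edges_def flip: sum_divide_distrib)
    qed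
    finally show ?thesis by simp
  qed
  \<comment> \<open>A positive perimeter lets the extended real quotient agree with the real one;
    for an unbounded tile it is \<open>1 / \<infinity> = 0\<close>.\<close>
  have recip: "real_of_ereal (1 / perimeter G T) = (if bounded T then 1 / ?p T else 0)" if "T \<in> tiles G" for T
    using perimeter_pos[of T] that by (auto simp: perimeter_def one_ereal_def)
  have tile_sum: "(\<Sum>e\<in>?E. \<Sum>T\<in>{T \<in> tiles G. earc G e \<subseteq> frontier T}.
      ?l e * real_of_ereal (1 / perimeter G T)) = card ?BT"
  proof -
    have "(\<Sum>e\<in>?E. \<Sum>T\<in>{T \<in> tiles G. earc G e \<subseteq> frontier T}. ?l e * real_of_ereal (1 / perimeter G T))
        = (\<Sum>T\<in>tiles G. \<Sum>e | e \<in> ?E \<and> earc G e \<subseteq> frontier T. ?l e * real_of_ereal (1 / perimeter G T))"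
      by (rule sum.swap_restrict[OF fin(2) tiles(1)])
    also have "\<dots> = (\<Sum>T\<in>tiles G. if bounded T then 1 else 0)"
    proof (intro sum.cong refl)
      fix T assume "T \<in> tiles G"
      have "(\<Sum>e | e \<in> ?E \<and> earc G e \<subseteq> frontier T. ?l e * real_of_ereal (1 / perimeter G T))
          = ?p T * real_of_ereal (1 / perimeter G T)"
        by (simp add: boundary_edges_def sum_distrib_right)
      then show "(\<Sum>e | e \<in> ?E \<and> earc G e \<subseteq> frontier T. ?l e * real_of_ereal (1 / perimeter G T))
          = (if bounded T then 1 else 0)"
        using recip[OF \<open>T \<in> tiles G\<close>] perimeter_pos[of T] \<open>T \<in> tiles G\<close> by (cases "bounded T") auto
    qed
    also have "\<dots> = card ?BT"
      using tiles(1) by (simp add: sum.If_cases Int_def)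
    finally show ?thesis .
  qed
  have "(\<Sum>e\<in>?E. - characteristic_value G e * ?l e)
      = (\<Sum>e\<in>?E. (\<Sum>v\<in>e. ?l e / vertex_weight G v)
          + (\<Sum>T\<in>{T \<in> tiles G. earc G e \<subseteq> frontier T}. ?l e * real_of_ereal (1 / perimeter G T)) - 1)"
  proof (intro sum.cong refl)
    fix e assume "e \<in> ?E"
    \<comment> \<open>Needed to cancel \<open>?l e\<close> against \<open>1 / ?l e\<close>, which
      produces the summand \<open>- 1\<close> for each edge.\<close>
    then have "?l e \<noteq> 0" using len by force
    then show "- characteristic_value G e * ?l e
      = (\<Sum>v\<in>e. ?l e / vertex_weight G v)
          + (\<Sum>T\<in>{T \<in> tiles G. earc G e \<subseteq> frontier T}. ?l e * real_of_ereal (1 / perimeter G T)) - 1"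
      by (simp add: characteristic_value_def algebra_simps sum_distrib_left)
  qed
  also have "\<dots> = real (card ?V) + real (card ?BT) - real (card ?E)"
    by (simp add: sum.distrib sum_subtractf vertex_sum tile_sum)
  also have "\<dots> = 1"
    using tiles(2) by linarith
  finally show ?thesis .
qed

end
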